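(* Let $k\in rpd(\Omega,X,H)$ and let $K(s,t):=\mathbb{E}[k(\cdot,s,t)]=\int_\Omega k(\omega,s,t)\,d\mathbb{P}(\omega)$, $s,t\in X$, be its mean kernel. Let $k^{(1)},\dots,k^{(m)}$ be i.i.d. copies of $k$ defined on the product space $(\Omega^m,\mathbb{P}^{\otimes m})$, and define the empirical kernel $$\overline{k}_m(\omega_1,\dots,\omega_m,s,t):=\frac1m\sum_{r=1}^m k^{(r)}(\omega_r,s,t).$$ Then $\overline{k}_m\in rpd(\Omega^m,X,H)$ and $\mathbb{E}[\overline{k}_m]=K$. Moreover, for $s,t\in X$, $$\overline{k}_m(\cdot,s,t)\xrightarrow[m\to\infty]{\text{a.s.}}K(s,t)$$ in the weak operator topology.
   Context: $X$ is a nonempty set, $H$ a Hilbert space with inner product linear in the second variable, $\mathcal{L}(H)$ the space of bounded linear operators on $H$, and $(\Omega,\mathbb{P})$ a probability space. $rpd(\Omega,X,H)$ is the set of random positive definite kernels: maps $k:\Omega\times X\times X\to\mathcal{L}(H)$ such that for all $s,t\in X$ the map $k(\cdot,s,t)$ is strongly measurable on $\Omega$, and $$\mathbb{E}\Big[\sum_{i,j=1}^N\langle a_i,k(\cdot,s_i,s_j)a_j\rangle\Big]\ge 0$$ for all finite families $\{(a_i,s_i)\}_{i=1}^N$ with $a_i\in H$, $s_i\in X$. The set $rpd(\Omega^m,X,H)$ is defined in the same way with $(\Omega^m,\mathbb{P}^{\otimes m})$ in place of $(\Omega,\mathbb{P})$. It is understood that the expectations exist: $\omega\mapsto\langle a,k(\omega,s,t)b\rangle$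 is integrable for all $a,b\in H$, $s,t\in X$, and $\mathbb{E}[k(\cdot,s,t)]\in\mathcal{L}(H)$ satisfies $\langle a,\mathbb{E}[k(\cdot,s,t)]b\rangle=\mathbb{E}[\langle a,k(\cdot,s,t)b\rangle]$. For the limit $m\to\infty$, all $\overline{k}_m$ are regarded as functions on the infinite product space $(\Omega^{\mathbb{N}},\mathbb{P}^{\otimes\mathbb{N}})$ through the first $m$ coordinates, and "a.s." refers to that measure.
   Formalization: Almost sure weak operator convergence is stated for each pair a, b in H separately (the null set may depend on a, b); one common null set fails under weak integrability, e.g. k = 2^n P_n with probability 2^-n on l^2. *)

theory Defs
  imports "HOL-Probability.Probability"
begin

text \<open>Complex Hilbert spaces; the inner product is linear in the second variable.
  The last axiom gives positivity, definiteness and compatibility with the complete norm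
  all at once.\<close>

class complex_hilbert = banach +
  fixes scaleC :: "complex \<Rightarrow> 'a \<Rightarrow> 'a"
    and cinner :: "'a \<Rightarrow> 'a \<Rightarrow> complex"
  assumes scaleC_add_right: "scaleC c (x + y) = scaleC c x + scaleC c y"
    and scaleC_add_left: "scaleC (c + d) x = scaleC c x + scaleC d x"
    and scaleC_scaleC: "scaleC c (scaleC d x) = scaleC (c * d) x"
    and scaleC_one: "scaleC 1 x = x"
    and scaleR_scaleC: "scaleR r x = scaleC (complex_of_real r) x"
    and cinner_commute: "cinner x y = cnj (cinner y x)"
    and cinner_add_right: "cinner x (y + z) = cinner x y + cinner x z"
    and cinner_scaleC_right: "cinner x (scaleC c y) = c * cinner x y"
    and cinner_self: "cinner x x = complex_of_real ((norm x)\<^sup>2)"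

instantiation complex :: complex_hilbert
begin

definition scaleC_complex :: "complex \<Rightarrow> complex \<Rightarrow> complex"
  where "scaleC_complex c x = c * x"

definition cinner_complex :: "complex \<Rightarrow> complex \<Rightarrow> complex"
  where "cinner_complex x y = cnj x * y"

instance
proof
  fix x :: complex
  show "cinner x x = complex_of_real ((norm x)\<^sup>2)"
    by (simp add: cinner_complex_def complex_norm_square mult.commute del: of_real_power)
qed (simp_all add: scaleC_complex_def cinner_complex_def distrib_left distrib_right
      scaleR_conv_of_real)

end

text \<open>The space \<open>\<L>(H)\<close>: \<open>'h \<Rightarrow>\<^sub>L 'h\<close> consists of the bounded real-linear operators.\<close>

definition clinear_ops :: "('h::complex_hilbert \<Rightarrow>\<^sub>L 'h) set"
  where "clinear_ops =
    {T. \<forall>c x. blinfun_apply T (scaleC c x) = scaleC c (blinfun_apply T x)}"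

text \<open>Strong measurability of a vector-valued map: pointwise norm limit of simple functions.
  Plain Borel measurability is weaker in general when the Hilbert space is not separable.\<close>

definition strongly_measurable :: "'w measure \<Rightarrow> ('w \<Rightarrow> 'h::real_normed_vector) \<Rightarrow> bool"
  where "strongly_measurable M f \<longleftrightarrow>
    (\<exists>F. (\<forall>n::nat. simple_function M (F n)) \<and>
         (\<forall>\<omega>\<in>space M. (\<lambda>n. F n \<omega>) \<longlonglongrightarrow> f \<omega>))"

text \<open>For operator-valued maps, strong measurability refers to the strong operator topology,
  i.e. it is required of all the orbits \<open>\<omega> \<mapsto> k \<omega> s t a\<close>.\<close>

definition random_kernel ::
    "'w measure \<Rightarrow> ('w \<Rightarrow> 'x \<Rightarrow> 'x \<Rightarrow> ('h::complex_hilbert \<Rightarrow>\<^sub>L 'h)) \<Rightarrow> bool"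
  where "random_kernel M k \<longleftrightarrow>
    (\<forall>s t. (\<forall>\<omega>\<in>space M. k \<omega> s t \<in> clinear_ops) \<and>
           (\<forall>a. strongly_measurable M (\<lambda>\<omega>. blinfun_apply (k \<omega> s t) a)))"

text \<open>Operator-valued expectations are weak integrals.\<close>

definition has_op_expectation ::
    "'w measure \<Rightarrow> ('w \<Rightarrow> ('h::complex_hilbert \<Rightarrow>\<^sub>L 'h)) \<Rightarrow> ('h \<Rightarrow>\<^sub>L 'h) \<Rightarrow> bool"
  where "has_op_expectation M T S \<longleftrightarrow> S \<in> clinear_ops \<and>
    (\<forall>a b. integrable M (\<lambda>\<omega>. cinner a (blinfun_apply (T \<omega>) b)) \<and>
           cinner a (blinfun_apply S b) = (LINT \<omega>|M. cinner a (blinfun_apply (T \<omega>) b)))"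

definition mean_kernel ::
    "'w measure \<Rightarrow> ('w \<Rightarrow> 'x \<Rightarrow> 'x \<Rightarrow> ('h::complex_hilbert \<Rightarrow>\<^sub>L 'h)) \<Rightarrow>
      'x \<Rightarrow> 'x \<Rightarrow> ('h \<Rightarrow>\<^sub>L 'h)"
  where "mean_kernel M k s t = (THE S. has_op_expectation M (\<lambda>\<omega>. k \<omega> s t) S)"

text \<open>The existence of the expectations is part of the definition, so that
  \<^const>\<open>mean_kernel\<close> is meaningful for every member of this set.\<close>

definition rpd ::
    "'w measure \<Rightarrow> ('w \<Rightarrow> 'x \<Rightarrow> 'x \<Rightarrow> ('h::complex_hilbert \<Rightarrow>\<^sub>L 'h)) set"
  where "rpd M = {k. random_kernel M k \<and>
    (\<forall>s t. \<exists>S. has_op_expectation M (\<lambda>\<omega>. k \<omega> s t) S) \<and>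
    (\<forall>(N::nat) a s.
      (LINT \<omega>|M. (\<Sum>i<N. \<Sum>j<N. cinner (a i) (blinfun_apply (k \<omega> (s i) (s j)) (a j))))
        \<in> \<real>\<^sub>\<ge>\<^sub>0)}"

text \<open>The law of a random kernel: the joint distribution of all matrix elements
  \<open>\<langle>a, k(\<cdot>, s, t) b\<rangle>\<close>, on the product sigma-algebra.\<close>

definition kernel_law ::
    "'w measure \<Rightarrow> ('w \<Rightarrow> 'x \<Rightarrow> 'x \<Rightarrow> ('h::complex_hilbert \<Rightarrow>\<^sub>L 'h)) \<Rightarrow>
      ('x \<times> 'x \<times> 'h \<times> 'h \<Rightarrow> complex) measure"
  where "kernel_law M k = distr M (\<Pi>\<^sub>M p\<in>UNIV. borel)
    (\<lambda>\<omega> (s, t, a, b). cinner a (blinfun_apply (k \<omega> s t) b))"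

definition kernel_copy ::
    "'w measure \<Rightarrow> ('w \<Rightarrow> 'x \<Rightarrow> 'x \<Rightarrow> ('h::complex_hilbert \<Rightarrow>\<^sub>L 'h)) \<Rightarrow>
      ('w \<Rightarrow> 'x \<Rightarrow> 'x \<Rightarrow> ('h \<Rightarrow>\<^sub>L 'h)) \<Rightarrow> bool"
  where "kernel_copy M k k' \<longleftrightarrow> random_kernel M k' \<and> kernel_law M k' = kernel_law M k"

text \<open>The \<open>r\<close>-th copy \<open>\<kappa> r\<close> is evaluated at the \<open>r\<close>-th coordinate, so on a product space
  the copies are independent. Coordinates and copies are numbered from \<open>0\<close>. Only the first
  \<open>m\<close> coordinates are used, so the same formula serves on the \<open>m\<close>-fold product (where
  points are extensional functions on \<open>{..<m}\<close>) and on the infinite product.\<close>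

definition empirical_kernel ::
    "(nat \<Rightarrow> 'w \<Rightarrow> 'x \<Rightarrow> 'x \<Rightarrow> ('h::complex_hilbert \<Rightarrow>\<^sub>L 'h)) \<Rightarrow> nat \<Rightarrow>
      (nat \<Rightarrow> 'w) \<Rightarrow> 'x \<Rightarrow> 'x \<Rightarrow> ('h \<Rightarrow>\<^sub>L 'h)"
  where "empirical_kernel \<kappa> m \<omega> s t = (1 / real m) *\<^sub>R (\<Sum>r<m. \<kappa> r (\<omega> r) s t)"

text \<open>Almost sure convergence in the weak operator topology, i.e. almost sure convergence of
  every matrix element; the exceptional null set may depend on \<open>a\<close> and \<open>b\<close>. A common null set
  cannot be had when expectations are only weak integrals: let \<open>T = 2 ^ n P\<^sub>n\<close> with probability
  \<open>2 ^ -n\<close>, where \<open>P\<^sub>n\<close> is the projection onto the \<open>n\<close>-th basis vector of \<open>\<ell>\<^sup>2\<close>. Its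
  expectation is the identity, but the averages of i.i.d. copies are almost surely unbounded
  in norm, hence by the uniform boundedness principle do not converge weakly.\<close>

definition AE_tendsto_wot ::
    "'w measure \<Rightarrow> (nat \<Rightarrow> 'w \<Rightarrow> ('h::complex_hilbert \<Rightarrow>\<^sub>L 'h)) \<Rightarrow> ('h \<Rightarrow>\<^sub>L 'h) \<Rightarrow> bool"
  where "AE_tendsto_wot M T S \<longleftrightarrow>
    (\<forall>a b. AE \<omega> in M. (\<lambda>m. cinner a (blinfun_apply (T m \<omega>) b))
                          \<longlonglongrightarrow> cinner a (blinfun_apply S b))"

end

theory Submission imports Defs
begin

text \<open>Everything is decided at the level of the matrix elements
  \<open>\<langle>a, k(\<cdot>, s, t) b\<rangle>\<close>. An operator-valued expectation is determined by them, since
  \<open>\<langle>a, x\<rangle> = \<langle>a, y\<rangle>\<close> for all \<open>a\<close> forces \<open>x = y\<close>; and equality of the laws of two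
  random kernels gives their matrix elements equal distributions. Hence every copy has
  the same mean kernel \<open>K\<close> as \<open>k\<close>, and averaging the copies does not change it.
  Positivity of the empirical kernel is then inherited: by linearity the expected
  quadratic form of a random kernel depends on its mean only
  (\<open>integral_kernel_form\<close>), and that of \<open>K\<close> is already known to be nonnegative.

  The almost sure convergence is the strong law of large numbers under the mere assumption of
  integrability, applied to the real and imaginary part of a single matrix element. It
  is proved here by the argument behind the maximal ergodic theorem. Let
  \<open>f\<close> be integrable with negative mean, and let \<open>R\<^sub>n\<close> be the largest of the partial
  sums \<open>0, f(\<omega>\<^sub>0), f(\<omega>\<^sub>0) + f(\<omega>\<^sub>1), \<dots>\<close> with at most \<open>n\<close> summands. Prepending a coordinate \<open>s\<close>
  to the sequence \<open>\<omega>\<close> preserves the product measure and gives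
  \<open>R\<^sub>n\<^sub>+\<^sub>1(s, \<omega>) - R\<^sub>n(\<omega>) = max (- R\<^sub>n(\<omega>)) (f s)\<close>. On the shift-invariant event \<open>A\<close> that
  \<open>R\<^sub>n\<close> is unbounded the right-hand side converges to \<open>f s\<close>, and its integral over \<open>A\<close>
  is nonnegative because \<open>R\<^sub>n\<close> increases with \<open>n\<close>. As \<open>A\<close> does not depend on \<open>s\<close>, in the limit
  \<open>0 \<le> P(A) \<cdot> E f\<close>, so \<open>P(A) = 0\<close>. Applied to \<open>f - E f - \<epsilon>\<close> and to \<open>E f - f - \<epsilon>\<close> this bounds the
  averages from both sides.\<close>

section \<open>A strong law of large numbers\<close>

text \<open>The maximum of the partial sums of \<open>f (\<omega> 0), f (\<omega> 1), \<dots>\<close> with at most \<open>n\<close> summands, the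
  empty sum included. The recursion splits off the first coordinate instead of the last one,
  because the strong law below compares this maximum with the one of the shifted sequence.\<close>
fun run_max :: "('a \<Rightarrow> real) \<Rightarrow> nat \<Rightarrow> (nat \<Rightarrow> 'a) \<Rightarrow> real" where
  "run_max f 0 \<omega> = 0"
| "run_max f (Suc n) \<omega> = max 0 (f (\<omega> 0) + run_max f n (\<lambda>i. \<omega> (Suc i)))"

lemma run_max_nonneg: "0 \<le> run_max f n \<omega>"
  by (cases n) auto

lemma run_max_le_Suc: "run_max f n \<omega> \<le> run_max f (Suc n) \<omega>"
proof (induction n arbitrary: \<omega>)
  case (Suc n)
  show ?case
    using Suc[of "\<lambda>i. \<omega> (Suc i)"] by (simp add: max_def)
qed simp

lemma incseq_run_max: "incseq (\<lambda>n. run_max f n \<omega>)"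
  by (rule incseq_SucI) (rule run_max_le_Suc)

lemma sum_le_run_max: "(\<Sum>i<n. f (\<omega> i)) \<le> run_max f n \<omega>"
proof (induction n arbitrary: \<omega>)
  case (Suc n)
  show ?case
    using Suc[of "\<lambda>i. \<omega> (Suc i)"] by (simp add: sum.lessThan_Suc_shift del: sum.lessThan_Suc)
qed simp

lemma run_max_le_sum_abs: "run_max f n \<omega> \<le> (\<Sum>i<n. \<bar>f (\<omega> i)\<bar>)"
proof (induction n arbitrary: \<omega>)
  case (Suc n)
  show ?case
    using Suc[of "\<lambda>i. \<omega> (Suc i)"]
    by (simp add: sum.lessThan_Suc_shift sum_nonneg del: sum.lessThan_Suc)
qed simp

text \<open>Quantifying over natural bounds makes measurability immediate.\<close>
definition run_max_unbounded :: "('a \<Rightarrow> real) \<Rightarrow> (nat \<Rightarrow> 'a) \<Rightarrow> bool"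
  where "run_max_unbounded f \<omega> \<longleftrightarrow> (\<forall>K::nat. \<exists>n. real K < run_max f n \<omega>)"

text \<open>One more initial term changes all later partial sums by the same finite amount, so
  unboundedness is a shift-invariant event.\<close>
lemma run_max_unbounded_case_nat:
  "run_max_unbounded f (case_nat s \<omega>) \<longleftrightarrow> run_max_unbounded f \<omega>"
proof
  assume L: "run_max_unbounded f (case_nat s \<omega>)"
  show "run_max_unbounded f \<omega>"
    unfolding run_max_unbounded_def
  proof
    fix K
    obtain m where m: "real (K + nat \<lceil>\<bar>f s\<bar>\<rceil>) < run_max f m (case_nat s \<omega>)"
      using L unfolding run_max_unbounded_def by blast
    also have "\<dots> \<le> run_max f (Suc m) (case_nat s \<omega>)"
      by (rule run_max_le_Suc)
    also have "\<dots> \<le> \<bar>f s\<bar> + run_max f m \<omega>"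
      using run_max_nonneg[of f m \<omega>] by simp
    finally have "real K < run_max f m \<omega>"
      by (simp, linarith)
    then show "\<exists>n. real K < run_max f n \<omega>" ..
  qed
next
  assume R: "run_max_unbounded f \<omega>"
  show "run_max_unbounded f (case_nat s \<omega>)"
    unfolding run_max_unbounded_def
  proof
    fix K
    obtain m where m: "real (K + nat \<lceil>\<bar>f s\<bar>\<rceil>) < run_max f m \<omega>"
      using R unfolding run_max_unbounded_def by blast
    have "f s + run_max f m \<omega> \<le> run_max f (Suc m) (case_nat s \<omega>)"
      by simp
    with m have "real K < run_max f (Suc m) (case_nat s \<omega>)"
      by (simp, linarith)
    then show "\<exists>n. real K < run_max f n (case_nat s \<omega>)" ..
  qed
qed

context sequence_space
begin

lemma measurable_run_max [measurable]:
  assumes [measurable]: "f \<in> borel_measurable M"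
  shows "run_max f n \<in> borel_measurable S"
proof (induction n)
  case (Suc n)
  note [measurable] = Suc
  have "(\<lambda>\<omega>. \<lambda>i. \<omega> (Suc i)) \<in> measurable S S"
    by (rule measurable_PiM_single') (auto simp: space_PiM)
  note [measurable] = measurable_compose[OF this Suc]
  show ?case by simp
qed simp

lemma measurable_run_max_unbounded [measurable]:
  assumes [measurable]: "f \<in> borel_measurable M"
  shows "Measurable.pred S (run_max_unbounded f)"
  unfolding run_max_unbounded_def[abs_def] by measurable

lemma integrable_coordinate:
  fixes f :: "_ \<Rightarrow> real"
  assumes "integrable M f"
  shows "integrable S (\<lambda>\<omega>. f (\<omega> i))"
  using assms integrable_distr_eq[of "\<lambda>\<omega>. \<omega> i" S M f] PiM_component[of i] by simp

lemma integrable_run_max: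
  assumes "integrable M f"
  shows "integrable S (run_max f n)"
proof (rule Bochner_Integration.integrable_bound)
  show "integrable S (\<lambda>\<omega>. \<Sum>i<n. \<bar>f (\<omega> i)\<bar>)"
    by (intro Bochner_Integration.integrable_sum integrable_abs integrable_coordinate assms)
  show "run_max f n \<in> borel_measurable S"
    using assms by measurable
  show "AE \<omega> in S. norm (run_max f n \<omega>) \<le> norm (\<Sum>i<n. \<bar>f (\<omega> i)\<bar>)"
    using run_max_nonneg[of f n] run_max_le_sum_abs[of f n] by (auto simp: sum_nonneg)
qed

text \<open>The heart of the strong law: sums with negative drift stay bounded above. On the event of
  unboundedness the increment of the running maximum eventually equals the new first
  term, which is independent of the event. Its integral there is thus
  \<open>P(A) \<cdot> E f\<close>, and it cannot be negative because running maxima increase.\<close>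
lemma AE_run_max_bounded:
  assumes f: "integrable M f" and neg: "(\<integral>x. f x \<partial>M) < 0"
  shows "AE \<omega> in S. \<not> run_max_unbounded f \<omega>"
proof -
  define A where "A = {\<omega>\<in>space S. run_max_unbounded f \<omega>}"
  define \<iota> where "\<iota> = (indicat_real A)"
  have [measurable]: "f \<in> borel_measurable M" using f by auto
  have [measurable]: "A \<in> sets S" unfolding A_def by measurable
  have [measurable]: "\<iota> \<in> borel_measurable S" unfolding \<iota>_def by measurable
  have \<iota>01: "\<bar>\<iota> \<omega>\<bar> \<le> 1" "0 \<le> \<iota> \<omega>" for \<omega> by (auto simp: \<iota>_def indicator_def)
  interpret MS: pair_prob_space M S ..
  let ?P = "M \<Otimes>\<^sub>M S"
  have shift: "(\<lambda>x. case_nat (fst x) (snd x)) \<in> measurable ?P S" by measurable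
  have iter: "distr ?P S (\<lambda>x. case_nat (fst x) (snd x)) = S"
    using PiM_iter by (simp add: split_beta')
  have \<iota>_shift: "\<iota> (case_nat s \<omega>) = \<iota> \<omega>" if "s \<in> space M" "\<omega> \<in> space S" for s \<omega>
  proof -
    have "case_nat s \<omega> \<in> space S"
      using that by (auto simp: space_PiM PiE_iff split: nat.split)
    with that show ?thesis
      by (simp add: \<iota>_def indicator_def A_def run_max_unbounded_case_nat)
  qed
  have int\<iota>: "integrable S (\<lambda>\<omega>. \<iota> \<omega> * run_max f n \<omega>)" for n
    by (rule Bochner_Integration.integrable_bound[OF integrable_run_max[OF f, of n]])
       (use \<iota>01 in \<open>auto simp: abs_mult intro!: mult_left_le_one_le\<close>)
  have fst_int: "integrable ?P (\<lambda>(s, \<omega>). f s)"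
    using integrable_distr_eq[of fst ?P M f] f by (simp add: P.distr_pair_fst split_beta')
  \<comment> \<open>The integrand of \<open>E[1\<^sub>A (R\<^sub>n\<^sub>+\<^sub>1 - R\<^sub>n)]\<close>, once both terms are written on \<open>M \<Otimes>\<^sub>M S\<close>:
    \<open>R\<^sub>n\<^sub>+\<^sub>1\<close> at the sequence with first term \<open>s\<close> and tail \<open>\<omega>\<close>, and \<open>R\<^sub>n\<close> at the tail \<open>\<omega>\<close>.\<close>
  define G where "G n = (\<lambda>(s, \<omega>). \<iota> \<omega> * max (- run_max f n \<omega>) (f s))" for n
  have G_meas [measurable]: "G n \<in> borel_measurable ?P" for n
    unfolding G_def by measurable
  have bound: "norm (G n x) \<le> \<bar>f (fst x)\<bar>" for n x
  proof -
    have "\<bar>max (- run_max f n (snd x)) (f (fst x))\<bar> \<le> \<bar>f (fst x)\<bar>"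
      using run_max_nonneg[of f n "snd x"] by auto
    then show ?thesis
      using \<iota>01[of "snd x"] mult_mono[of "\<bar>\<iota> (snd x)\<bar>" 1]
      by (fastforce simp: G_def split_beta' abs_mult)
  qed
  have distr_snd: "distr ?P S snd = S"
  proof -
    have "distr ?P S snd = distr (S \<Otimes>\<^sub>M M) S (snd \<circ> (\<lambda>(x, y). (y, x)))"
      by (subst MS.distr_pair_swap, subst distr_distr) auto
    also have "\<dots> = distr (S \<Otimes>\<^sub>M M) S fst"
      by (rule distr_cong) auto
    also have "\<dots> = S"
      by (rule M.distr_pair_fst)
    finally show ?thesis .
  qed
  have G_nonneg: "0 \<le> (\<integral>x. G n x \<partial>?P)" for n
  proof -
    let ?h = "\<lambda>n \<omega>. \<iota> \<omega> * run_max f n \<omega>"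
    have 1: "integrable ?P (\<lambda>x. ?h (Suc n) (case_nat (fst x) (snd x)))"
      "(\<integral>x. ?h (Suc n) (case_nat (fst x) (snd x)) \<partial>?P) = (\<integral>\<omega>. ?h (Suc n) \<omega> \<partial>S)"
      using integrable_distr_eq[OF shift, of "?h (Suc n)"] integral_distr[OF shift, of "?h (Suc n)"]
        int\<iota>[of "Suc n"] by (simp_all add: iter del: run_max.simps)
    have 2: "integrable ?P (\<lambda>x. ?h n (snd x))"
      "(\<integral>x. ?h n (snd x) \<partial>?P) = (\<integral>\<omega>. ?h n \<omega> \<partial>S)"
      using integrable_distr_eq[of snd ?P S "?h n"] integral_distr[of snd ?P S "?h n"]
        int\<iota>[of n] by (simp_all add: distr_snd)
    have "(\<integral>\<omega>. ?h n \<omega> \<partial>S) \<le> (\<integral>\<omega>. ?h (Suc n) \<omega> \<partial>S)"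
      by (intro integral_mono int\<iota> mult_left_mono run_max_le_Suc \<iota>01)
    then have "0 \<le> (\<integral>x. ?h (Suc n) (case_nat (fst x) (snd x)) - ?h n (snd x) \<partial>?P)"
      by (simp only: Bochner_Integration.integral_diff[OF 1(1) 2(1)] 1(2) 2(2))
    also have "\<dots> = (\<integral>x. G n x \<partial>?P)"
    proof (rule Bochner_Integration.integral_cong[OF refl])
      fix x assume "x \<in> space ?P"
      then have "\<iota> (case_nat (fst x) (snd x)) = \<iota> (snd x)"
        by (intro \<iota>_shift) (auto simp: space_pair_measure)
      then show "?h (Suc n) (case_nat (fst x) (snd x)) - ?h n (snd x) = G n x"
        by (simp add: G_def split_beta' right_diff_distrib[symmetric] max_def)
    qed
    finally show ?thesis .
  qed
  have lim: "(\<lambda>n. G n x) \<longlonglongrightarrow> \<iota> (snd x) * f (fst x)" if "x \<in> space ?P" for x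
  proof (cases "snd x \<in> A")
    case True
    then have "run_max_unbounded f (snd x)"
      by (simp add: A_def)
    then obtain m where m: "real (nat \<lceil>\<bar>f (fst x)\<bar>\<rceil>) < run_max f m (snd x)"
      unfolding run_max_unbounded_def by blast
    have "G n x = \<iota> (snd x) * f (fst x)" if "m \<le> n" for n
    proof -
      have "run_max f m (snd x) \<le> run_max f n (snd x)"
        using incseq_run_max that by (rule incseqD)
      with m have "- run_max f n (snd x) \<le> f (fst x)"
        by linarith
      then show ?thesis
        by (simp add: G_def split_beta')
    qed
    then show ?thesis
      by (intro tendsto_eventually eventually_sequentiallyI[of m])
  next
    case False
    then show ?thesis by (simp add: G_def \<iota>_def split_beta')
  qed
  have dom: "integrable ?P (\<lambda>x. \<bar>f (fst x)\<bar>)"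
    using fst_int by (intro integrable_abs) (simp add: split_beta')
  have "(\<lambda>n. \<integral>x. G n x \<partial>?P) \<longlonglongrightarrow> (\<integral>x. \<iota> (snd x) * f (fst x) \<partial>?P)"
    by (rule integral_dominated_convergence[OF _ _ dom]) (use lim bound in auto)
  then have "0 \<le> (\<integral>x. \<iota> (snd x) * f (fst x) \<partial>?P)"
    by (rule LIMSEQ_le_const) (use G_nonneg in auto)
  also have "\<dots> = (\<integral>\<omega>. (\<integral>s. \<iota> \<omega> * f s \<partial>M) \<partial>S)"
  proof -
    have "integrable ?P (\<lambda>x. \<iota> (snd x) * f (fst x))"
      by (rule Bochner_Integration.integrable_bound[OF dom])
         (use \<iota>01 in \<open>auto simp: abs_mult intro!: mult_left_le_one_le\<close>)
    then show ?thesis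
      by (subst MS.integral_snd) (simp_all add: split_beta')
  qed
  also have "\<dots> = measure S A * (\<integral>x. f x \<partial>M)"
    by (simp add: \<iota>_def)
  finally have "measure S A \<le> 0"
    using neg by (simp add: zero_le_mult_iff)
  then have "AE \<omega> in S. \<omega> \<notin> A"
    by (intro AE_not_in) (auto simp: null_sets_def P.emeasure_eq_measure measure_le_0_iff)
  then show ?thesis
    by (rule AE_mp) (auto simp: A_def)
qed

text \<open>Subtracting slightly more than the mean makes the drift negative. The slack runs through a
  sequence tending to \<open>0\<close>, so that one null set serves all of its values.\<close>
lemma AE_sum_le_linear:
  assumes f: "integrable M f"
  shows "AE \<omega> in S. \<forall>k. \<exists>C. \<forall>n. (\<Sum>i<n. f (\<omega> i)) \<le> C + real n * ((\<integral>x. f x \<partial>M) + 1 / real (Suc k))"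
  unfolding AE_all_countable
proof
  fix k
  define c where "c = (\<integral>x. f x \<partial>M) + 1 / real (Suc k)"
  have "(\<integral>x. f x - c \<partial>M) < 0"
    using f by (simp add: c_def M.prob_space)
  then have "AE \<omega> in S. \<not> run_max_unbounded (\<lambda>x. f x - c) \<omega>"
    using f by (intro AE_run_max_bounded) auto
  then show "AE \<omega> in S. \<exists>C. \<forall>n. (\<Sum>i<n. f (\<omega> i)) \<le> C + real n * ((\<integral>x. f x \<partial>M) + 1 / real (Suc k))"
    unfolding c_def[symmetric]
  proof (rule AE_mp, intro AE_I2 impI)
    fix \<omega> assume "\<not> run_max_unbounded (\<lambda>x. f x - c) \<omega>"
    then obtain K :: nat where "\<And>n. run_max (\<lambda>x. f x - c) n \<omega> \<le> K"
      by (auto simp: run_max_unbounded_def not_less)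
    then have "(\<Sum>i<n. f (\<omega> i) - c) \<le> K" for n
      using sum_le_run_max[where f="\<lambda>x. f x - c" and \<omega>=\<omega> and n=n] order_trans by blast
    then show "\<exists>C. \<forall>n. (\<Sum>i<n. f (\<omega> i)) \<le> C + real n * c"
      by (auto simp: sum_subtractf algebra_simps)
  qed
qed

end

lemma averages_tendsto:
  fixes s :: "nat \<Rightarrow> real"
  assumes upper: "\<And>k. \<exists>C. \<forall>n. s n \<le> C + real n * (\<mu> + 1 / real (Suc k))"
    and lower: "\<And>k. \<exists>C. \<forall>n. - s n \<le> C + real n * (- \<mu> + 1 / real (Suc k))"
  shows "(\<lambda>n. s n / real n) \<longlonglongrightarrow> \<mu>"
proof (rule LIMSEQ_I)
  fix r :: real assume r: "0 < r"
  obtain k where k: "1 / real (Suc k) < r / 2"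
    using nat_approx_posE[of "r / 2"] r by (metis half_gt_zero)
  obtain C D where C: "\<And>n. s n \<le> C + real n * (\<mu> + 1 / real (Suc k))"
    and D: "\<And>n. - s n \<le> D + real n * (- \<mu> + 1 / real (Suc k))"
    using upper[of k] lower[of k] by blast
  define B where "B = \<bar>C\<bar> + \<bar>D\<bar>"
  obtain N where N: "2 * B / r < real N"
    using reals_Archimedean2 by blast
  have "norm (s n / real n - \<mu>) < r" if n: "Suc N \<le> n" for n
  proof -
    have n0: "0 < real n" using n by simp
    have "2 * B / r < real n" using N n by simp
    then have B: "B < real n * (r / 2)" using r by (simp add: field_simps)
    define q where "q = real n * (1 / real (Suc k))"
    have "q \<le> real n * (r / 2)"
      unfolding q_def using k by (intro mult_left_mono) auto
    moreover have "s n \<le> C + (real n * \<mu> + q)" "- s n \<le> D + (- (real n * \<mu>) + q)"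
      using C[of n] D[of n] unfolding q_def distrib_left mult_minus_right by auto
    moreover have "real n * (r / 2) + real n * (r / 2) = real n * r"
      by simp
    ultimately have "\<bar>s n - real n * \<mu>\<bar> < real n * r"
      using B unfolding B_def by linarith
    moreover have "s n / real n - \<mu> = (s n - real n * \<mu>) / real n"
      using n0 by (simp add: field_simps)
    ultimately show ?thesis
      using n0 by (simp add: field_simps)
  qed
  then show "\<exists>N. \<forall>n\<ge>N. norm (s n / real n - \<mu>) < r" by blast
qed

theorem (in sequence_space) strong_law_of_large_numbers:
  fixes f :: "_ \<Rightarrow> real"
  assumes f: "integrable M f"
  shows "AE \<omega> in S. (\<lambda>n. (\<Sum>i<n. f (\<omega> i)) / real n) \<longlonglongrightarrow> (\<integral>x. f x \<partial>M)"
proof -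
  have "AE \<omega> in S. \<forall>k. \<exists>C. \<forall>n. (\<Sum>i<n. - f (\<omega> i)) \<le> C + real n * ((\<integral>x. - f x \<partial>M) + 1 / real (Suc k))"
    using f by (intro AE_sum_le_linear) auto
  with AE_sum_le_linear[OF f] show ?thesis
  proof eventually_elim
    case (elim \<omega>)
    then show ?case
      by (intro averages_tendsto) (simp_all add: sum_negf)
  qed
qed

text \<open>Both sides agree on cylinder sets, whose preimages are again cylinder sets.\<close>
lemma distr_PiM_coordinatewise:
  assumes "\<And>i. i \<in> I \<Longrightarrow> prob_space (M i)"
    and f [measurable]: "\<And>i. i \<in> I \<Longrightarrow> f i \<in> measurable (M i) (N i)"
  shows "distr (PiM I M) (PiM I N) (\<lambda>\<omega>. \<lambda>i\<in>I. f i (\<omega> i)) = PiM I (\<lambda>i. distr (M i) (N i) (f i))"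
    (is "?L = ?R")
proof (rule measure_eqI_PiM_infinite)
  show "sets ?L = sets (PiM I N)" "sets ?R = sets (PiM I N)"
    by (auto intro!: sets_PiM_cong)
  have meas: "(\<lambda>\<omega>. \<lambda>i\<in>I. f i (\<omega> i)) \<in> measurable (PiM I M) (PiM I N)"
    by measurable
  show "finite_measure ?L"
    using assms by (intro prob_space.finite_measure prob_space.prob_space_distr prob_space_PiM meas)
  fix A J assume J: "finite J" "J \<subseteq> I" and A: "\<And>i. i \<in> J \<Longrightarrow> A i \<in> sets (N i)"
  define B where "B i = f i -` A i \<inter> space (M i)" for i
  have B: "B i \<in> sets (M i)" if "i \<in> J" for i
    using that J A f unfolding B_def by (intro measurable_sets[of _ _ "N i"]) auto
  have "emeasure ?L (prod_emb I N J (Pi\<^sub>E J A)) =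
    emeasure (PiM I M) ((\<lambda>\<omega>. \<lambda>i\<in>I. f i (\<omega> i)) -` prod_emb I N J (Pi\<^sub>E J A) \<inter> space (PiM I M))"
    using J A by (intro emeasure_distr meas sets_PiM_I) auto
  also have "(\<lambda>\<omega>. \<lambda>i\<in>I. f i (\<omega> i)) -` prod_emb I N J (Pi\<^sub>E J A) \<inter> space (PiM I M) =
      prod_emb I M J (Pi\<^sub>E J B)"
    using J f[THEN measurable_space] A[THEN sets.sets_into_space]
    by (fastforce simp: B_def prod_emb_def space_PiM PiE_iff restrict_def extensional_def)
  also have "emeasure (PiM I M) \<dots> = (\<Prod>i\<in>J. emeasure (M i) (B i))"
    using assms J B by (intro emeasure_PiM_emb) auto
  also have "\<dots> = (\<Prod>i\<in>J. emeasure (distr (M i) (N i) (f i)) (A i))"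
    using J A f by (intro prod.cong refl) (auto simp: B_def emeasure_distr subset_eq)
  also have "\<dots> = emeasure ?R (prod_emb I (\<lambda>i. distr (M i) (N i) (f i)) J (Pi\<^sub>E J A))"
    using assms J A by (intro emeasure_PiM_emb[symmetric] prob_space.prob_space_distr) auto
  also have "prod_emb I (\<lambda>i. distr (M i) (N i) (f i)) J (Pi\<^sub>E J A) = prod_emb I N J (Pi\<^sub>E J A)"
    by (simp add: prod_emb_def)
  finally show "emeasure ?L (prod_emb I N J (Pi\<^sub>E J A)) = emeasure ?R (prod_emb I N J (Pi\<^sub>E J A))" .
qed

text \<open>When the maps \<open>X i\<close> differ, shifting the sample points does not shift the sequence of the values
  \<open>X i (\<omega> i)\<close>. This sequence is, however, distributed as the infinite product of the common law, on
  which the strong law applies to the identity function.\<close>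
lemma strong_law_identically_distributed:
  fixes X :: "nat \<Rightarrow> 'a \<Rightarrow> real"
  assumes "prob_space M"
    and X [measurable]: "\<And>n. X n \<in> borel_measurable M"
    and Y: "integrable M Y" and law: "\<And>n. distr M borel (X n) = distr M borel Y"
  shows "AE \<omega> in (\<Pi>\<^sub>M i\<in>(UNIV::nat set). M).
    (\<lambda>n. (\<Sum>i<n. X i (\<omega> i)) / real n) \<longlonglongrightarrow> (\<integral>x. Y x \<partial>M)"
proof -
  interpret prob_space M by fact
  define \<nu> where "\<nu> = distr M borel Y"
  have [measurable]: "Y \<in> borel_measurable M" using Y by auto
  interpret \<nu>: prob_space \<nu> unfolding \<nu>_def by (rule prob_space_distr) simp
  interpret \<nu>: sequence_space \<nu> ..
  have "AE x in PiM (UNIV::nat set) (\<lambda>_. \<nu>). (\<lambda>n. (\<Sum>i<n. x i) / real n) \<longlonglongrightarrow> (\<integral>x. x \<partial>\<nu>)"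
    using Y by (intro \<nu>.strong_law_of_large_numbers) (simp add: \<nu>_def integrable_distr_eq)
  also have "(\<integral>x. x \<partial>\<nu>) = (\<integral>x. Y x \<partial>M)"
    unfolding \<nu>_def by (subst integral_distr) auto
  also have "PiM (UNIV::nat set) (\<lambda>_. \<nu>) =
      distr (PiM UNIV (\<lambda>_. M)) (PiM UNIV (\<lambda>_. borel)) (\<lambda>\<omega>. \<lambda>i\<in>UNIV. X i (\<omega> i))"
    unfolding \<nu>_def by (subst distr_PiM_coordinatewise) (simp_all add: law prob_space_axioms)
  finally show ?thesis
    by (auto dest: AE_distrD[rotated])
qed

lemma strong_law_identically_distributed_complex:
  fixes X :: "nat \<Rightarrow> 'a \<Rightarrow> complex"
  assumes M: "prob_space M"
    and X [measurable]: "\<And>n. X n \<in> borel_measurable M"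
    and Y: "integrable M Y" and law: "\<And>n. distr M borel (X n) = distr M borel Y"
  shows "AE \<omega> in (\<Pi>\<^sub>M i\<in>(UNIV::nat set). M).
    (\<lambda>n. (1 / real n) *\<^sub>R (\<Sum>i<n. X i (\<omega> i))) \<longlonglongrightarrow> (\<integral>x. Y x \<partial>M)"
proof -
  have [measurable]: "Y \<in> borel_measurable M" using Y by auto
  have law_image: "distr M borel (\<lambda>x. g (X n x)) = distr M borel (\<lambda>x. g (Y x))"
    if [measurable]: "g \<in> borel_measurable borel" for g :: "complex \<Rightarrow> real" and n
    using arg_cong[OF law, of "\<lambda>N. distr N borel g" n] by (simp add: distr_distr comp_def)
  have "AE \<omega> in (\<Pi>\<^sub>M i\<in>(UNIV::nat set). M).
      (\<lambda>n. (\<Sum>i<n. Re (X i (\<omega> i))) / real n) \<longlonglongrightarrow> (\<integral>x. Re (Y x) \<partial>M)"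
    using Y by (intro strong_law_identically_distributed M law_image) auto
  moreover have "AE \<omega> in (\<Pi>\<^sub>M i\<in>(UNIV::nat set). M).
      (\<lambda>n. (\<Sum>i<n. Im (X i (\<omega> i))) / real n) \<longlonglongrightarrow> (\<integral>x. Im (Y x) \<partial>M)"
    using Y by (intro strong_law_identically_distributed M law_image) auto
  ultimately show ?thesis
  proof eventually_elim
    case (elim \<omega>)
    then show ?case
      using Y by (simp add: tendsto_complex_iff)
  qed
qed

section \<open>The inner product and complex-linear operators\<close>

lemma cinner_zero_right [simp]: "cinner x 0 = 0"
  using cinner_add_right[of x 0 0] by simp

lemma cinner_diff_right: "cinner x (y - z) = cinner x y - cinner x z"
  using cinner_add_right[of x "y - z" z] by simp

lemma cinner_scaleR_right: "cinner x (r *\<^sub>R y) = r *\<^sub>R cinner x y"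
  by (simp only: scaleR_scaleC[of r y] cinner_scaleC_right scaleR_conv_of_real)

lemma cinner_sum_right: "cinner x (\<Sum>i\<in>I. y i) = (\<Sum>i\<in>I. cinner x (y i))"
  by (induction I rule: infinite_finite_induct) (simp_all add: cinner_add_right)

lemma cinner_add_left: "cinner (x + y) z = cinner x z + cinner y z"
  by (metis cinner_add_right cinner_commute complex_cnj_add)

lemma cinner_scaleC_left: "cinner (scaleC c x) y = cnj c * cinner x y"
  by (metis cinner_commute cinner_scaleC_right complex_cnj_mult)

lemma cinner_ext:
  assumes "\<And>a. cinner a x = cinner a y"
  shows "x = y"
proof -
  have "cinner (x - y) (x - y) = 0"
    by (simp add: cinner_diff_right assms)
  then show ?thesis
    by (simp add: cinner_self)
qed

text \<open>Polarization makes the inner product a continuous function of norms; this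
  yields the measurability of the matrix elements.\<close>
lemma Re_cinner_conv_norm: "Re (cinner x y) = ((norm (x + y))\<^sup>2 - (norm x)\<^sup>2 - (norm y)\<^sup>2) / 2"
proof -
  have "complex_of_real ((norm (x + y))\<^sup>2) =
      of_real ((norm x)\<^sup>2) + cinner x y + cnj (cinner x y) + of_real ((norm y)\<^sup>2)"
    by (simp only: cinner_self[symmetric] cinner_add_left cinner_add_right
        cinner_commute[of y x] ac_simps)
  from arg_cong[OF this, of Re] show ?thesis
    by simp
qed

lemma Im_cinner_conv_Re: "Im (cinner x y) = Re (cinner (scaleC \<i> x) y)"
  by (simp add: cinner_scaleC_left)

lemma continuous_on_cinner: "continuous_on A (cinner x)"
proof -
  have eq: "cinner x = (\<lambda>y. complex_of_real (Re (cinner x y)) + \<i> * complex_of_real (Im (cinner x y)))"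
    by (rule ext) (rule complex_eq)
  show ?thesis
    by (subst eq, unfold Im_cinner_conv_Re Re_cinner_conv_norm) (intro continuous_intros; simp)
qed

lemma scaleC_scaleR_commute:
  fixes x :: "'h::complex_hilbert"
  shows "scaleC c (r *\<^sub>R x) = r *\<^sub>R scaleC c x"
  by (simp add: scaleR_scaleC scaleC_scaleC mult.commute)

lemma scaleC_zero_right: "scaleC c (0::'h::complex_hilbert) = 0"
  using scaleC_add_right[of c "0::'h" 0] by simp

lemma scaleR_clinear_ops: "T \<in> clinear_ops \<Longrightarrow> r *\<^sub>R T \<in> clinear_ops"
  by (simp add: clinear_ops_def blinfun.scaleR_left scaleC_scaleR_commute)

lemma sum_clinear_ops: "(\<And>i. i \<in> I \<Longrightarrow> T i \<in> clinear_ops) \<Longrightarrow> (\<Sum>i\<in>I. T i) \<in> clinear_ops"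
  by (induction I rule: infinite_finite_induct)
     (simp_all add: clinear_ops_def blinfun.add_left scaleC_add_right scaleC_zero_right)

section \<open>Random kernels and their expectations\<close>

lemma strongly_measurable_cinner:
  assumes "strongly_measurable M f"
  shows "(\<lambda>\<omega>. cinner a (f \<omega>)) \<in> borel_measurable M"
proof -
  obtain F where F: "\<And>n. simple_function M (F n)"
    and lim: "\<And>\<omega>. \<omega> \<in> space M \<Longrightarrow> (\<lambda>n. F n \<omega>) \<longlonglongrightarrow> f \<omega>"
    using assms unfolding strongly_measurable_def by blast
  show ?thesis
  proof (rule borel_measurable_LIMSEQ_metric)
    show "(\<lambda>\<omega>. cinner a (F n \<omega>)) \<in> borel_measurable M" for n
      by (intro borel_measurable_simple_function simple_function_compose1[OF F])
    show "(\<lambda>n. cinner a (F n \<omega>)) \<longlonglongrightarrow> cinner a (f \<omega>)" if "\<omega> \<in> space M" for \<omega>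
      using continuous_on_tendsto_compose[OF continuous_on_cinner lim[OF that], of UNIV] by simp
  qed
qed

lemma strongly_measurable_comp:
  assumes "T \<in> measurable N M" "strongly_measurable M f"
  shows "strongly_measurable N (\<lambda>\<omega>. f (T \<omega>))"
proof -
  obtain F where F: "\<And>n. simple_function M (F n)"
    and lim: "\<And>\<omega>. \<omega> \<in> space M \<Longrightarrow> (\<lambda>n. F n \<omega>) \<longlonglongrightarrow> f \<omega>"
    using assms(2) unfolding strongly_measurable_def by blast
  show ?thesis
    unfolding strongly_measurable_def
    using simple_function_comp[OF assms(1) F] lim measurable_space[OF assms(1)]
    by (intro exI[of _ "\<lambda>n \<omega>. F n (T \<omega>)"]) auto
qed

lemma strongly_measurable_scaleR:
  assumes "strongly_measurable M f"
  shows "strongly_measurable M (\<lambda>\<omega>. r *\<^sub>R f \<omega>)"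
proof -
  obtain F where F: "\<And>n. simple_function M (F n)"
    and lim: "\<And>\<omega>. \<omega> \<in> space M \<Longrightarrow> (\<lambda>n. F n \<omega>) \<longlonglongrightarrow> f \<omega>"
    using assms unfolding strongly_measurable_def by blast
  show ?thesis
    unfolding strongly_measurable_def
    by (intro exI[of _ "\<lambda>n \<omega>. r *\<^sub>R F n \<omega>"] conjI allI ballI
        simple_function_compose1[OF F] tendsto_scaleR tendsto_const lim)
qed

text \<open>The sum is taken of the approximating simple functions: in a nonseparable space Borel
  measurability of the summands need not carry over to the sum.\<close>
lemma strongly_measurable_sum:
  assumes "\<And>i. i \<in> I \<Longrightarrow> strongly_measurable M (f i)"
  shows "strongly_measurable M (\<lambda>\<omega>. \<Sum>i\<in>I. f i \<omega>)"
proof -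
  obtain F where F: "\<And>i n. i \<in> I \<Longrightarrow> simple_function M (F i n)"
    and lim: "\<And>i \<omega>. i \<in> I \<Longrightarrow> \<omega> \<in> space M \<Longrightarrow> (\<lambda>n. F i n \<omega>) \<longlonglongrightarrow> f i \<omega>"
    using assms unfolding strongly_measurable_def by metis
  show ?thesis
    unfolding strongly_measurable_def
    by (intro exI[of _ "\<lambda>n \<omega>. \<Sum>i\<in>I. F i n \<omega>"] conjI allI ballI
        simple_function_sum tendsto_sum F lim)
qed

lemma random_kernel_cinner_measurable:
  assumes "random_kernel M k"
  shows "(\<lambda>\<omega>. cinner a (k \<omega> s t b)) \<in> borel_measurable M"
  using assms unfolding random_kernel_def by (intro strongly_measurable_cinner) auto

lemma has_op_expectation_unique:
  assumes "has_op_expectation M T S" "has_op_expectation M T S'"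
  shows "S = S'"
proof (rule blinfun_eqI)
  fix b
  show "S b = S' b"
    using assms by - (rule cinner_ext, simp add: has_op_expectation_def)
qed

lemma mean_kernel_eqI:
  assumes "has_op_expectation M (\<lambda>\<omega>. k \<omega> s t) S"
  shows "mean_kernel M k s t = S"
  unfolding mean_kernel_def using assms has_op_expectation_unique by blast

text \<open>The law of a kernel lives on a product space, of which the distribution of a single matrix
  element is a marginal.\<close>
lemma kernel_copy_distr:
  assumes k: "random_kernel M k" and copy: "kernel_copy M k k'"
  shows "distr M borel (\<lambda>\<omega>. cinner a (k' \<omega> s t b)) = distr M borel (\<lambda>\<omega>. cinner a (k \<omega> s t b))"
proof -
  have marginal: "distr (kernel_law M h) borel (\<lambda>f. f (s, t, a, b)) =
      distr M borel (\<lambda>\<omega>. cinner a (h \<omega> s t b))"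
    if h: "random_kernel M h" for h :: "'a \<Rightarrow> 'b \<Rightarrow> 'b \<Rightarrow> ('c \<Rightarrow>\<^sub>L 'c)"
  proof -
    have "(\<lambda>\<omega> (s, t, a, b). cinner a (h \<omega> s t b)) \<in> measurable M (\<Pi>\<^sub>M p\<in>UNIV. borel)"
      by (rule measurable_PiM_single') (auto intro: random_kernel_cinner_measurable[OF h])
    then show ?thesis
      unfolding kernel_law_def by (subst distr_distr) (auto simp: comp_def)
  qed
  have "random_kernel M k'" "kernel_law M k' = kernel_law M k"
    using copy by (simp_all add: kernel_copy_def)
  with marginal[of k] marginal[of k'] k show ?thesis
    by simp
qed

lemma integrable_cong_distr:
  fixes f g :: "'a \<Rightarrow> 'b::{banach, second_countable_topology}"
  assumes "f \<in> borel_measurable M" "g \<in> borel_measurable M"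
    and "distr M borel f = distr M borel g"
  shows "integrable M f \<longleftrightarrow> integrable M g" and "(\<integral>x. f x \<partial>M) = (\<integral>x. g x \<partial>M)"
proof -
  show "integrable M f \<longleftrightarrow> integrable M g"
    using integrable_distr_eq[of f M borel "\<lambda>x. x"] integrable_distr_eq[of g M borel "\<lambda>x. x"] assms
    by simp
  show "(\<integral>x. f x \<partial>M) = (\<integral>x. g x \<partial>M)"
    using integral_distr[of f M borel "\<lambda>x. x"] integral_distr[of g M borel "\<lambda>x. x"] assms
    by simp
qed

lemma kernel_copy_has_op_expectation:
  assumes k: "random_kernel M k" and copy: "kernel_copy M k k'"
    and S: "has_op_expectation M (\<lambda>\<omega>. k \<omega> s t) S"
  shows "has_op_expectation M (\<lambda>\<omega>. k' \<omega> s t) S"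
proof -
  have k': "random_kernel M k'" using copy by (simp add: kernel_copy_def)
  show ?thesis
    using S integrable_cong_distr[OF random_kernel_cinner_measurable[OF k']
        random_kernel_cinner_measurable[OF k] kernel_copy_distr[OF k copy]]
    by (simp add: has_op_expectation_def)
qed

lemma random_kernel_empirical:
  assumes "\<And>r. random_kernel M (\<kappa> r)"
  shows "random_kernel (\<Pi>\<^sub>M r\<in>{..<m}. M) (empirical_kernel \<kappa> m)"
  unfolding random_kernel_def empirical_kernel_def
proof (intro allI conjI ballI)
  fix s t \<omega> assume "\<omega> \<in> space (\<Pi>\<^sub>M r\<in>{..<m}. M)"
  then show "(1 / real m) *\<^sub>R (\<Sum>r<m. \<kappa> r (\<omega> r) s t) \<in> clinear_ops"
    using assms unfolding random_kernel_def
    by (intro scaleR_clinear_ops sum_clinear_ops) (auto simp: space_PiM PiE_iff)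
next
  fix s t a
  have "strongly_measurable (\<Pi>\<^sub>M r\<in>{..<m}. M) (\<lambda>\<omega>. \<kappa> r (\<omega> r) s t a)" if "r \<in> {..<m}" for r
    using assms that unfolding random_kernel_def
    by (intro strongly_measurable_comp[of "\<lambda>\<omega>. \<omega> r" _ M "\<lambda>x. \<kappa> r x s t a"]) auto
  then show "strongly_measurable (\<Pi>\<^sub>M r\<in>{..<m}. M)
      (\<lambda>\<omega>. ((1 / real m) *\<^sub>R (\<Sum>r<m. \<kappa> r (\<omega> r) s t)) a)"
    unfolding blinfun.scaleR_left blinfun.sum_left
    by (intro strongly_measurable_scaleR strongly_measurable_sum)
qed

lemma cinner_empirical_kernel:
  "cinner a (empirical_kernel \<kappa> m \<omega> s t b) = (1 / real m) *\<^sub>R (\<Sum>r<m. cinner a (\<kappa> r (\<omega> r) s t b))"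
  by (simp add: empirical_kernel_def blinfun.scaleR_left blinfun.sum_left
      cinner_scaleR_right cinner_sum_right)

lemma has_op_expectation_empirical:
  assumes M: "prob_space M" and m: "1 \<le> m"
    and S: "\<And>r. has_op_expectation M (\<lambda>\<omega>. \<kappa> r \<omega> s t) S"
  shows "has_op_expectation (\<Pi>\<^sub>M r\<in>{..<m}. M) (\<lambda>\<omega>. empirical_kernel \<kappa> m \<omega> s t) S"
  unfolding has_op_expectation_def cinner_empirical_kernel
proof (intro conjI allI)
  let ?P = "\<Pi>\<^sub>M r\<in>{..<m}. M"
  show "S \<in> clinear_ops"
    using S by (simp add: has_op_expectation_def)
  fix a b
  have int: "integrable M (\<lambda>\<omega>. cinner a (\<kappa> r \<omega> s t b))"
    and mean: "(\<integral>\<omega>. cinner a (\<kappa> r \<omega> s t b) \<partial>M) = cinner a (S b)" for r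
    using S by (simp_all add: has_op_expectation_def)
  have proj: "distr ?P M (\<lambda>\<omega>. \<omega> r) = M" if "r < m" for r
    using distr_PiM_component[of "{..<m}" "\<lambda>_. M" r] M that by simp
  have int_proj: "integrable ?P (\<lambda>\<omega>. cinner a (\<kappa> r (\<omega> r) s t b))"
    and mean_proj: "(\<integral>\<omega>. cinner a (\<kappa> r (\<omega> r) s t b) \<partial>?P) = cinner a (S b)" if "r < m" for r
    using integrable_distr_eq[of "\<lambda>\<omega>. \<omega> r" ?P M "\<lambda>\<omega>. cinner a (\<kappa> r \<omega> s t b)"]
      integral_distr[of "\<lambda>\<omega>. \<omega> r" ?P M "\<lambda>\<omega>. cinner a (\<kappa> r \<omega> s t b)"]
      int[of r] mean[of r] proj[OF that] that by auto
  show "integrable ?P (\<lambda>\<omega>. (1 / real m) *\<^sub>R (\<Sum>r<m. cinner a (\<kappa> r (\<omega> r) s t b)))"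
    using int_proj by (intro integrable_scaleR_right Bochner_Integration.integrable_sum) auto
  have "(\<integral>\<omega>. (1 / real m) *\<^sub>R (\<Sum>r<m. cinner a (\<kappa> r (\<omega> r) s t b)) \<partial>?P) =
      (1 / real m) *\<^sub>R (\<Sum>r<m. cinner a (S b))"
    using int_proj mean_proj by (simp add: Bochner_Integration.integral_sum del: sum_constant)
  also have "\<dots> = cinner a (S b)"
    using m by (simp add: scaleR_conv_of_real)
  finally show "cinner a (S b) =
      (\<integral>\<omega>. (1 / real m) *\<^sub>R (\<Sum>r<m. cinner a (\<kappa> r (\<omega> r) s t b)) \<partial>?P)" ..
qed

text \<open>Expected quadratic forms depend on the mean kernel only; positivity of a kernel therefore
  passes to every kernel with the same mean.\<close>
lemma integral_kernel_form:
  assumes "\<And>s t. has_op_expectation M (\<lambda>\<omega>. k \<omega> s t) (K s t)"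
  shows "(\<integral>\<omega>. (\<Sum>i<N. \<Sum>j<N. cinner (a i) (k \<omega> (s i) (s j) (a j))) \<partial>M) =
    (\<Sum>i<N::nat. \<Sum>j<N. cinner (a i) (K (s i) (s j) (a j)))"
  using assms unfolding has_op_expectation_def
  by (simp add: Bochner_Integration.integral_sum)

theorem proposition6:
  fixes M :: "'w measure"
    and k :: "'w \<Rightarrow> 'x \<Rightarrow> 'x \<Rightarrow> ('h::complex_hilbert \<Rightarrow>\<^sub>L 'h)"
    and \<kappa> :: "nat \<Rightarrow> 'w \<Rightarrow> 'x \<Rightarrow> 'x \<Rightarrow> ('h \<Rightarrow>\<^sub>L 'h)"
  assumes "prob_space M"
    and "k \<in> rpd M"
    and "\<And>r. kernel_copy M k (\<kappa> r)"
  shows "(\<forall>m\<ge>1. empirical_kernel \<kappa> m \<in> rpd (\<Pi>\<^sub>M r\<in>{..<m}. M) \<and>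
                 mean_kernel (\<Pi>\<^sub>M r\<in>{..<m}. M) (empirical_kernel \<kappa> m) = mean_kernel M k) \<and>
         (\<forall>s t. AE_tendsto_wot (\<Pi>\<^sub>M r\<in>(UNIV::nat set). M)
                  (\<lambda>m \<omega>. empirical_kernel \<kappa> m \<omega> s t) (mean_kernel M k s t))"
proof -
  define K where "K = mean_kernel M k"
  have k: "random_kernel M k" and \<kappa>: "random_kernel M (\<kappa> r)" for r
    using assms by (auto simp: rpd_def kernel_copy_def)
  have K: "has_op_expectation M (\<lambda>\<omega>. k \<omega> s t) (K s t)" for s t
  proof -
    obtain T where T: "has_op_expectation M (\<lambda>\<omega>. k \<omega> s t) T"
      using assms(2) unfolding rpd_def by blast
    with mean_kernel_eqI[where k=k, OF T] show ?thesis
      by (simp add: K_def)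
  qed
  have K\<kappa>: "has_op_expectation M (\<lambda>\<omega>. \<kappa> r \<omega> s t) (K s t)" for r s t
    using k assms(3) K by (rule kernel_copy_has_op_expectation)
  have pos: "(\<Sum>i<N. \<Sum>j<N. cinner (a i) (K (s i) (s j) (a j))) \<in> \<real>\<^sub>\<ge>\<^sub>0" for N :: nat and a s
  proof -
    have "(\<integral>\<omega>. (\<Sum>i<N. \<Sum>j<N. cinner (a i) (k \<omega> (s i) (s j) (a j))) \<partial>M) \<in> \<real>\<^sub>\<ge>\<^sub>0"
      using assms(2) unfolding rpd_def by blast
    then show ?thesis
      by (simp only: integral_kernel_form[where k=k and K=K, OF K])
  qed
  have "empirical_kernel \<kappa> m \<in> rpd (\<Pi>\<^sub>M r\<in>{..<m}. M) \<and>
      mean_kernel (\<Pi>\<^sub>M r\<in>{..<m}. M) (empirical_kernel \<kappa> m) = K" if m: "1 \<le> m" for m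
  proof -
    have E: "has_op_expectation (\<Pi>\<^sub>M r\<in>{..<m}. M) (\<lambda>\<omega>. empirical_kernel \<kappa> m \<omega> s t) (K s t)" for s t
      using assms(1) m K\<kappa> by (rule has_op_expectation_empirical)
    then have "mean_kernel (\<Pi>\<^sub>M r\<in>{..<m}. M) (empirical_kernel \<kappa> m) = K"
      by (intro ext mean_kernel_eqI)
    moreover have "empirical_kernel \<kappa> m \<in> rpd (\<Pi>\<^sub>M r\<in>{..<m}. M)"
      unfolding rpd_def mem_Collect_eq
    proof (intro conjI allI)
      show "random_kernel (\<Pi>\<^sub>M r\<in>{..<m}. M) (empirical_kernel \<kappa> m)"
        by (rule random_kernel_empirical) (rule \<kappa>)
      show "\<exists>S. has_op_expectation (\<Pi>\<^sub>M r\<in>{..<m}. M) (\<lambda>\<omega>. empirical_kernel \<kappa> m \<omega> s t) S" for s t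
        using E by blast
      show "(\<integral>\<omega>. (\<Sum>i<N. \<Sum>j<N. cinner (a i) (empirical_kernel \<kappa> m \<omega> (s i) (s j) (a j)))
          \<partial>(\<Pi>\<^sub>M r\<in>{..<m}. M)) \<in> \<real>\<^sub>\<ge>\<^sub>0" for N :: nat and a s
        unfolding integral_kernel_form[where k="empirical_kernel \<kappa> m" and K=K, OF E] by (rule pos)
    qed
    ultimately show ?thesis
      by blast
  qed
  moreover have "AE_tendsto_wot (\<Pi>\<^sub>M r\<in>(UNIV::nat set). M)
      (\<lambda>m \<omega>. empirical_kernel \<kappa> m \<omega> s t) (K s t)" for s t
    unfolding AE_tendsto_wot_def cinner_empirical_kernel
  proof (intro allI)
    fix a b
    have "integrable M (\<lambda>\<omega>. cinner a (k \<omega> s t b))"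
      and mean: "cinner a (K s t b) = (\<integral>\<omega>. cinner a (k \<omega> s t b) \<partial>M)"
      using K by (simp_all add: has_op_expectation_def)
    then show "AE \<omega> in (\<Pi>\<^sub>M r\<in>(UNIV::nat set). M).
        (\<lambda>m. (1 / real m) *\<^sub>R (\<Sum>r<m. cinner a (\<kappa> r (\<omega> r) s t b))) \<longlonglongrightarrow> cinner a (K s t b)"
      unfolding mean
      by (intro strong_law_identically_distributed_complex
          [where X="\<lambda>r \<omega>. cinner a (\<kappa> r \<omega> s t b)"]
          assms(1) random_kernel_cinner_measurable \<kappa> kernel_copy_distr k assms(3))
  qed
  ultimately show ?thesis
    unfolding K_def by blast
qed

end
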